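(* For all integers $n\ge1$ and $0\le s\le n$, and an indeterminate $\lambda$, $$A_n\det(I_s-\lambda M)=\det(K_n-\lambda E_{n,s}),$$ where $A_n=\prod_{j=0}^{n-1}\frac{(3j+1)!}{(n+j)!}$, $M=M^{(n,s)}$ is the $s\times s$ matrix defined in the context, $K_n$ is the $n\times n$ matrix with entries $$(K_n)_{ij}=\binom{i+j}{i}+(-1)^i\binom ji-(-1)^j\binom ij\qquad(0\le i,j<n),$$ and $E_{n,s}=\operatorname{diag}(0_{n-s},I_s)$ is the diagonal matrix whose first $n-s$ diagonal entries are $0$ and whose last $s$ diagonal entries are $1$.
   Context: All matrices are indexed from zero; binomial coefficients outside their natural range are zero (so $\binom ji=0$ if $i>j$); the empty determinant is $1$. For $m\ge1$ define $$h_m(z)=\sum_{a=0}^{m-1}\frac{\binom{m+a-1}{m-1}\binom{2m-a-2}{m-1}}{\binom{3m-2}{m-1}}z^a,\qquad b_m=h_m(0)>0 .$$ Given $n,s$, put $r=n-s$ and $m_i=r+i+1$ for $0\le i<s$. The matrix $M=(M_{ij})_{0\le i,j<s}$ is $$f_i^{\pm}(z)=\bigl(1\pm(-1)^{i+1}z\bigr)(1-z)^i z^{-i-1}h_{m_i}(z),\qquad M_{ij}=b_{m_j}^{-1}\operatorname{Res}_{z=0}\operatorname{Res}_{w=0}\frac{f_i^+(z)f_j^-(w)}{1-z-w}.$$ Equivalently, the double residue is the coefficient of $z^{-1}w^{-1}$ when $1/(1-z-w)$ is expanded as a power series at $(z,w)=(0,0)$. *)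

theory Defs
  imports
    "HOL-Computational_Algebra.Formal_Laurent_Series"
    "Jordan_Normal_Form.Determinant"
begin

definition h_poly :: "nat \<Rightarrow> 'a::field_char_0 \<Rightarrow> 'a" where
  "h_poly m z = (\<Sum>a<m. of_nat ((m + a - 1) choose (m - 1)) * of_nat ((2 * m - a - 2) choose (m - 1))
                   / of_nat ((3 * m - 2) choose (m - 1)) * z ^ a)"

definition b_const :: "nat \<Rightarrow> rat" where
  "b_const m = h_poly m 0"

definition m_idx :: "nat \<Rightarrow> nat \<Rightarrow> nat \<Rightarrow> nat" where
  "m_idx n s i = (n - s) + i + 1"

text \<open>The rational functions \<open>f\<^sub>i\<^sup>\<plusminus>\<close> can be evaluated in any field of characteristic 0,
  in particular at the two formal variables below.\<close>

definition f_plus :: "nat \<Rightarrow> nat \<Rightarrow> nat \<Rightarrow> 'a::field_char_0 \<Rightarrow> 'a" where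
  "f_plus n s i z = (1 + (-1) ^ (i + 1) * z) * (1 - z) ^ i * z powi (- int i - 1) * h_poly (m_idx n s i) z"

definition f_minus :: "nat \<Rightarrow> nat \<Rightarrow> nat \<Rightarrow> 'a::field_char_0 \<Rightarrow> 'a" where
  "f_minus n s i z = (1 - (-1) ^ (i + 1) * z) * (1 - z) ^ i * z powi (- int i - 1) * h_poly (m_idx n s i) z"

text \<open>Iterated Laurent series \<open>\<rat>((z))((w))\<close>: the outer variable is \<open>w\<close>, so the outer residue of an
  element is its residue in \<open>w\<close>, a Laurent series in \<open>z\<close>. Since \<open>1 - z\<close> is a unit of \<open>\<rat>[[z]]\<close>,
  the inverse of \<open>1 - z - w\<close> in this field is its power series expansion at \<open>(0,0)\<close>;
  see \<open>inverse_kernel_nth\<close>.\<close>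

definition var_z :: "rat fls fls" where
  "var_z = fls_const fls_X"

definition var_w :: "rat fls fls" where
  "var_w = fls_X"

definition res_z_res_w :: "rat fls fls \<Rightarrow> rat" where
  "res_z_res_w F = fls_residue (fls_residue F)"

definition M_mat :: "nat \<Rightarrow> nat \<Rightarrow> rat mat" where
  "M_mat n s = mat s s (\<lambda>(i, j).
     inverse (b_const (m_idx n s j)) *
     res_z_res_w (f_plus n s i var_z * f_minus n s j var_w / (1 - var_z - var_w)))"

definition K_mat :: "nat \<Rightarrow> rat mat" where
  "K_mat n = mat n n (\<lambda>(i, j).
     of_nat ((i + j) choose i) + (-1) ^ i * of_nat (j choose i) - (-1) ^ j * of_nat (i choose j))"

definition E_mat :: "nat \<Rightarrow> nat \<Rightarrow> rat mat" where
  "E_mat n s = mat n n (\<lambda>(i, j). if i = j \<and> n - s \<le> i then 1 else 0)"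

definition A_const :: "nat \<Rightarrow> rat" where
  "A_const n = (\<Prod>j<n. fact (3 * j + 1) / fact (n + j))"

definition const_poly_mat :: "rat mat \<Rightarrow> rat poly mat" where
  "const_poly_mat B = map_mat (\<lambda>x. [:x:]) B"

definition lam :: "rat poly" where
  "lam = [:0, 1:]"

lemma inverse_kernel_nth:
  "fls_nth (fls_nth (inverse (1 - var_z - var_w)) (int l)) (int k) = of_nat ((k + l) choose k)"
proof -
  define P :: "nat \<Rightarrow> rat fps" where "P l = Abs_fps (\<lambda>k. of_nat ((k + l) choose k))" for l
  define G :: "rat fls fps" where "G = Abs_fps (\<lambda>l. fps_to_fls (P l))"
  have P0: "(1 - fps_X) * P 0 = 1"
    by (rule fps_ext) (auto simp: P_def algebra_simps fps_X_mult_nth)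
  have PS: "(1 - fps_X) * P (Suc l) = P l" for l
  proof (rule fps_ext)
    fix k show "fps_nth ((1 - fps_X) * P (Suc l)) k = fps_nth (P l) k"
      by (cases k) (simp_all add: P_def left_diff_distrib)
  qed
  have z1: "(1 - fls_X) * fps_to_fls (P 0) = 1"
    using arg_cong[OF P0, of fps_to_fls] by (simp add: fls_times_fps_to_fls)
  have zS: "(1 - fls_X) * fps_to_fls (P (Suc l)) = fps_to_fls (P l)" for l
    using arg_cong[OF PS, of fps_to_fls l] by (simp add: fls_times_fps_to_fls)
  have "(fps_const (1 - fls_X) - fps_X) * G = 1"
  proof (rule fps_ext)
    fix l show "fps_nth ((fps_const (1 - fls_X) - fps_X) * G) l = fps_nth 1 l"
      by (cases l) (simp_all add: G_def left_diff_distrib[of "fps_const (1 - fls_X)"] z1 zS)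
  qed
  from arg_cong[OF this, of fps_to_fls]
  have "(1 - var_z - var_w) * fps_to_fls G = 1"
    by (simp add: fls_times_fps_to_fls var_z_def var_w_def fls_minus_const[symmetric])
  then have "inverse (1 - var_z - var_w) = fps_to_fls G"
    by (rule inverse_unique)
  then show ?thesis by (simp add: G_def P_def)
qed

end

theory Submission
  imports Defs
begin

text \<open>Write \<open>J = m - 1\<close> and let \<open>C(p, d)\<close> be the coefficient of \<open>t\<^sup>d\<close> in \<open>(1 - t)\<^sup>p h\<^sub>m(t)\<close>. Up to a
  constant \<open>h\<^sub>m(t)\<close> is the hypergeometric polynomial \<open>F(J + 1, - J; - 2 J; t)\<close>, whose exponent
  differences at \<open>0\<close>, \<open>1\<close>, \<open>\<infinity>\<close> agree; it is therefore palindromic, and Pfaff's transformation maps it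
  to itself modulo \<open>t\<^bsup>2J+1\<^esup>\<close>, which reads \<open>C(p, d) = (-1)\<^sup>d C(J + d - p, d)\<close>. These two symmetries
  identify the last row of the inverse of the leading block of \<open>K\<^sub>n\<close> of size \<open>J + 1\<close>: its entries are
  combinations of \<open>C(J, J - k)\<close> and \<open>C(J + 1, J - k)\<close>. Transposing \<open>K\<^sub>n\<close> flips a sign \<open>e\<close> in this
  description, so the rows for \<open>e\<close> and \<open>- e\<close> are biorthogonal with respect to \<open>K\<^sub>n\<close>, with
  diagonal Gram matrix \<open>diag(b\<^sub>1, \<dots>, b\<^sub>n)\<close>. Expanding \<open>1 / (1 - z - w)\<close> by Vandermonde, the residues
  defining \<open>M\<close> turn out, up to signs, to be the products of the lower right blocks of the two
  triangular matrices of rows; hence multiplying \<open>K\<^sub>n - \<lambda> E\<close> by these matrices on both sides gives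
  a block diagonal matrix with blocks \<open>diag(b\<^sub>1, \<dots>, b\<^sub>r)\<close> and, up to diagonal factors, \<open>I - \<lambda> M\<close>.
  Finally \<open>b\<^sub>m = A\<^sub>m\<^sub>-\<^sub>1 / A\<^sub>m\<close>.\<close>

section \<open>Coefficients of \<open>(1 - t)\<^sup>p h(t)\<close> and their symmetries\<close>

lemma minus_one_power_cancel: "(-1) ^ k * ((-1) ^ k * x) = (x :: 'a :: comm_ring_1)"
  by (simp add: mult.assoc[symmetric] power_add[symmetric])

text \<open>The series \<open>(1 - X)^p\<close>. A rational exponent lets reflected exponents such
  as \<open>J + d - p\<close> become negative without truncation.\<close>

definition one_minus_X_powr :: "rat \<Rightarrow> rat fps" where
  "one_minus_X_powr p = Abs_fps (\<lambda>k. (-1) ^ k * (p gchoose k))"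

lemma one_minus_X_powr_nth: "fps_nth (one_minus_X_powr p) k = (-1) ^ k * (p gchoose k)"
  by (simp add: one_minus_X_powr_def)

lemma one_minus_X_powr_add:
  "one_minus_X_powr p * one_minus_X_powr q = one_minus_X_powr (p + q)"
proof (rule fps_ext)
  fix k
  have "fps_nth (one_minus_X_powr p * one_minus_X_powr q) k
      = (\<Sum>i=0..k. (-1) ^ k * ((p gchoose i) * (q gchoose (k - i))))"
    by (auto simp: fps_mult_nth one_minus_X_powr_nth power_add[symmetric] mult_ac intro!: sum.cong)
  then show "fps_nth (one_minus_X_powr p * one_minus_X_powr q) k = fps_nth (one_minus_X_powr (p + q)) k"
    by (simp add: one_minus_X_powr_nth gbinomial_Vandermonde sum_distrib_left[symmetric])
qed

lemma one_minus_X_powr_0: "one_minus_X_powr 0 = 1"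
  by (rule fps_ext) (simp add: one_minus_X_powr_nth gbinomial_0_left)

lemma one_minus_X_powr_1: "one_minus_X_powr 1 = 1 - fps_X"
proof (rule fps_ext)
  fix k
  show "fps_nth (one_minus_X_powr 1) k = fps_nth (1 - fps_X) k"
    using binomial_gbinomial[of 1 k, where 'a = rat]
    by (cases "k = 0"; cases "k = 1") (auto simp: one_minus_X_powr_nth fps_X_def binomial_eq_0)
qed

lemma one_minus_X_powr_of_nat: "one_minus_X_powr (of_nat n) = (1 - fps_X) ^ n"
proof (induction n)
  case 0
  show ?case by (simp add: one_minus_X_powr_0)
next
  case (Suc n)
  then show ?case
    using one_minus_X_powr_add[of 1 "of_nat n"] by (simp add: one_minus_X_powr_1)
qed

lemma one_minus_X_powr_of_nat_nth:
  "fps_nth (one_minus_X_powr (of_nat n)) k = (-1) ^ k * of_nat (n choose k)"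
  by (simp add: one_minus_X_powr_nth binomial_gbinomial)

text \<open>Upper negation. Through it the Pascal entries \<open>(k + l) choose k\<close> act as
  convolution kernels.\<close>

lemma one_minus_X_powr_neg_nth:
  "fps_nth (one_minus_X_powr (- of_nat l - 1)) k = of_nat ((k + l) choose k)"
proof -
  have "fps_nth (one_minus_X_powr (- of_nat l - 1)) k = of_nat (k + l) gchoose k"
    using gbinomial_negated_upper[of "- of_nat l - 1 :: rat" k]
    by (simp add: one_minus_X_powr_nth minus_one_power_cancel)
  then show ?thesis by (simp add: binomial_gbinomial)
qed

text \<open>This is \<open>h_m\<close> with \<open>m = J + 1\<close>. The cutoff matters for
  \<open>J = 0\<close>, where the truncated \<open>2 * J - a\<close> would make every coefficient 1;
  for \<open>J > 0\<close> the second binomial vanishes beyond \<open>J\<close> anyway.\<close>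

definition h_fps :: "nat \<Rightarrow> rat fps" where
  "h_fps J = Abs_fps (\<lambda>a. if a \<le> J
     then of_nat ((J + a) choose J) * of_nat ((2 * J - a) choose J) / of_nat ((3 * J + 1) choose J) else 0)"

definition hcoeff :: "nat \<Rightarrow> rat \<Rightarrow> nat \<Rightarrow> rat" where
  "hcoeff J p d = fps_nth (h_fps J * one_minus_X_powr p) d"

lemma hcoeff_add:
  "hcoeff J (p + q) d = (\<Sum>k\<le>d. hcoeff J p (d - k) * fps_nth (one_minus_X_powr q) k)"
proof -
  have "hcoeff J (p + q) d = fps_nth (one_minus_X_powr q * (h_fps J * one_minus_X_powr p)) d"
    by (simp add: hcoeff_def one_minus_X_powr_add[symmetric] mult_ac)
  then show ?thesis
    by (simp add: fps_mult_nth[of "one_minus_X_powr q"] hcoeff_def atMost_atLeast0 mult.commute)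
qed

lemma hcoeff_add_1: "hcoeff J (p + 1) (Suc d) = hcoeff J p (Suc d) - hcoeff J p d"
proof -
  have "hcoeff J (p + 1) (Suc d) = fps_nth (h_fps J * one_minus_X_powr p * (1 - fps_X)) (Suc d)"
    by (simp add: hcoeff_def one_minus_X_powr_add[symmetric] one_minus_X_powr_1 mult_ac)
  then show ?thesis by (simp add: right_diff_distrib hcoeff_def)
qed

lemma hcoeff_at_0: "hcoeff J p 0 = fps_nth (h_fps J) 0"
  by (simp add: hcoeff_def one_minus_X_powr_nth)

section \<open>Palindromy and the Pfaff symmetry\<close>

lemma h_fps_palindromic: "d \<le> J \<Longrightarrow> fps_nth (h_fps J) (J - d) = fps_nth (h_fps J) d"
  by (simp add: h_fps_def mult_2)

text \<open>The sum is the coefficient of \<open>t^J\<close> in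
  \<open>(1 - t)^d (1 - t)^(- J - 1)\<close>; upper negation evaluates it.\<close>

lemma alternating_binomial_sum:
  assumes "d \<le> J"
  shows "(\<Sum>a\<le>d. (-1) ^ a * of_nat (d choose a) * of_nat ((2 * J - a) choose J))
       = (of_nat ((2 * J - d) choose J) :: rat)"
proof -
  have "(\<Sum>a\<le>d. (-1) ^ a * of_nat (d choose a) * of_nat ((2 * J - a) choose J))
      = (\<Sum>a\<le>d. fps_nth (one_minus_X_powr (of_nat d)) a
           * fps_nth (one_minus_X_powr (- of_nat J - 1)) (J - a))"
  proof (rule sum.cong[OF refl])
    fix a assume "a \<in> {..d}"
    then have "(2 * J - a) choose J = (J - a + J) choose (J - a)"
      using assms binomial_symmetric[of J "2 * J - a"] by (simp add: mult_2)
    then show "(-1) ^ a * of_nat (d choose a) * of_nat ((2 * J - a) choose J) =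
        fps_nth (one_minus_X_powr (of_nat d)) a * fps_nth (one_minus_X_powr (- of_nat J - 1)) (J - a)"
      by (simp add: one_minus_X_powr_of_nat_nth one_minus_X_powr_neg_nth)
  qed
  also have "\<dots> = (\<Sum>a\<in>{0..J}. fps_nth (one_minus_X_powr (of_nat d)) a
           * fps_nth (one_minus_X_powr (- of_nat J - 1)) (J - a))"
    using assms by (intro sum.mono_neutral_left) (auto simp: one_minus_X_powr_of_nat_nth)
  also have "\<dots> = fps_nth (one_minus_X_powr (of_nat d - of_nat J - 1)) J"
    using one_minus_X_powr_add[of "of_nat d" "- of_nat J - 1"]
    by (simp add: fps_mult_nth[symmetric] algebra_simps)
  also have "\<dots> = (of_nat (2 * J - d) gchoose J)"
  proof -
    have "of_nat J - (of_nat d - of_nat J - 1) - 1 = (of_nat (2 * J - d) :: rat)"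
      using assms by (simp add: of_nat_diff)
    then show ?thesis
      unfolding one_minus_X_powr_nth gbinomial_negated_upper[of "of_nat d - of_nat J - 1 :: rat" J]
      by (simp only: minus_one_power_cancel)
  qed
  also have "\<dots> = of_nat ((2 * J - d) choose J)"
    by (rule binomial_gbinomial[symmetric])
  finally show ?thesis .
qed

text \<open>The coefficient of \<open>t^d\<close> in Pfaff's identity
  \<open>h(t) = (1 - t)^(- J - 1) h(- t / (1 - t))\<close>.\<close>

lemma h_fps_Pfaff:
  assumes "d \<le> J"
  shows "fps_nth (h_fps J) d = (\<Sum>a\<le>d. (-1) ^ a * fps_nth (h_fps J) a * of_nat ((J + d) choose (d - a)))"
proof -
  let ?N = "of_nat ((3 * J + 1) choose J) :: rat"
  have "(\<Sum>a\<le>d. (-1) ^ a * fps_nth (h_fps J) a * of_nat ((J + d) choose (d - a)))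
      = (\<Sum>a\<le>d. of_nat ((J + d) choose J) / ?N
           * ((-1) ^ a * of_nat (d choose a) * of_nat ((2 * J - a) choose J)))"
  proof (rule sum.cong[OF refl])
    fix a assume "a \<in> {..d}"
    then have a: "a \<le> d" by simp
    \<comment> \<open>Trinomial revision pulls \<open>(J + d) choose J\<close> out of the sum and
      leaves the alternating sum evaluated above.\<close>
    have "((J + d) choose (J + a)) * ((J + a) choose J) = ((J + d) choose J) * (d choose a)"
      using choose_mult[of J "J + a" "J + d"] a by simp
    moreover have "(J + d) choose (J + a) = (J + d) choose (d - a)"
      using binomial_symmetric[of "J + a" "J + d"] a by simp
    ultimately have eq: "of_nat ((J + d) choose (d - a)) * of_nat ((J + a) choose J)
        = (of_nat ((J + d) choose J) * of_nat (d choose a) :: rat)"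
      by (metis of_nat_mult)
    have "(-1) ^ a * fps_nth (h_fps J) a * of_nat ((J + d) choose (d - a))
        = (-1) ^ a * (of_nat ((J + d) choose (d - a)) * of_nat ((J + a) choose J))
            * of_nat ((2 * J - a) choose J) / ?N"
      using a assms by (simp add: h_fps_def)
    also have "\<dots> = of_nat ((J + d) choose J) / ?N
        * ((-1) ^ a * of_nat (d choose a) * of_nat ((2 * J - a) choose J))"
      unfolding eq by simp
    finally show "(-1) ^ a * fps_nth (h_fps J) a * of_nat ((J + d) choose (d - a)) = \<dots>" .
  qed
  also have "\<dots> = fps_nth (h_fps J) d"
    unfolding sum_distrib_left[symmetric] alternating_binomial_sum[OF assms]
    using assms by (simp add: h_fps_def)
  finally show ?thesis ..
qed

text \<open>Expanding \<open>h\<close> by \<open>h_fps_Pfaff\<close> and exchanging the sums leaves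
  a Vandermonde sum, whose exponent is then reflected by upper negation. The new exponent depends on
  \<open>d\<close>, so this is a symmetry of single coefficients, not of whole series.\<close>

lemma hcoeff_Pfaff:
  assumes "d \<le> J"
  shows "hcoeff J p d = (-1) ^ d * hcoeff J (of_nat J + of_nat d - p) d"
proof -
  let ?h = "fps_nth (h_fps J)" and ?B = "\<lambda>q. fps_nth (one_minus_X_powr q)"
  have "hcoeff J p d = (\<Sum>a\<le>d. (\<Sum>b\<le>a. (-1) ^ b * ?h b * of_nat ((J + a) choose (a - b))) * ?B p (d - a))"
    unfolding hcoeff_def fps_mult_nth atMost_atLeast0[symmetric]
    using assms by (intro sum.cong refl arg_cong2[where f = "(*)"] h_fps_Pfaff) auto
  also have "\<dots> = (\<Sum>a\<le>d. \<Sum>b\<le>a. (-1) ^ b * ?h b * (of_nat ((J + a) choose (a - b)) * ?B p (d - a)))"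
    by (simp add: sum_distrib_right mult.assoc)
  also have "\<dots> = (\<Sum>b\<le>d. \<Sum>a=b..d. (-1) ^ b * ?h b * (of_nat ((J + a) choose (a - b)) * ?B p (d - a)))"
    unfolding sum.Sigma[OF finite_atMost ballI[OF finite_atMost]]
      sum.Sigma[OF finite_atMost ballI[OF finite_atLeastAtMost]]
    by (rule sum.reindex_bij_witness[of _ "\<lambda>(b, a). (a, b)" "\<lambda>(a, b). (b, a)"]) auto
  also have "\<dots> = (\<Sum>b\<le>d. (-1) ^ b * ?h b * ?B (p - of_nat (J + b) - 1) (d - b))"
  proof (rule sum.cong[OF refl])
    fix b assume "b \<in> {..d}"
    then have b: "b \<le> d" by simp
    have "(\<Sum>a=b..d. of_nat ((J + a) choose (a - b)) * ?B p (d - a))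
        = (\<Sum>c=0..d - b. ?B (- of_nat (J + b) - 1) c * ?B p (d - b - c))"
      by (rule sum.reindex_bij_witness[of _ "\<lambda>c. c + b" "\<lambda>a. a - b"])
        (use b in \<open>auto simp del: of_nat_add simp: one_minus_X_powr_neg_nth add_ac\<close>)
    also have "\<dots> = ?B (p - of_nat (J + b) - 1) (d - b)"
      unfolding fps_mult_nth[symmetric] one_minus_X_powr_add by (simp add: algebra_simps)
    finally show "(\<Sum>a=b..d. (-1) ^ b * ?h b * (of_nat ((J + a) choose (a - b)) * ?B p (d - a)))
        = (-1) ^ b * ?h b * ?B (p - of_nat (J + b) - 1) (d - b)"
      by (simp add: sum_distrib_left[symmetric])
  qed
  \<comment> \<open>Upper negation in degree \<open>d - b\<close> contributes
    \<open>(-1)^(d - b)\<close>, which joins \<open>(-1)^b\<close> to a sign independent of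
    \<open>b\<close>.\<close>
  also have "\<dots> = (\<Sum>b\<le>d. (-1) ^ d * (?h b * ?B (of_nat J + of_nat d - p) (d - b)))"
  proof (rule sum.cong[OF refl])
    fix b assume "b \<in> {..d}"
    then obtain c where c: "d = b + c" by (auto simp: le_iff_add)
    show "(-1) ^ b * ?h b * ?B (p - of_nat (J + b) - 1) (d - b)
        = (-1) ^ d * (?h b * ?B (of_nat J + of_nat d - p) (d - b))"
      using gbinomial_negated_upper[of "p - of_nat (J + b) - 1 :: rat" c]
      by (simp add: c one_minus_X_powr_nth power_add algebra_simps)
  qed
  also have "\<dots> = (-1) ^ d * hcoeff J (of_nat J + of_nat d - p) d"
    by (simp add: hcoeff_def fps_mult_nth atMost_atLeast0 sum_distrib_left)
  finally show ?thesis .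
qed

lemma hcoeff_of_nat_eq_0: "q + J < d \<Longrightarrow> hcoeff J (of_nat q) d = 0"
  unfolding hcoeff_def fps_mult_nth
  by (intro sum.neutral) (auto simp: h_fps_def one_minus_X_powr_of_nat_nth)

text \<open>Reversing the coefficients of \<open>(1 - t)^q h(t)\<close>, taken in degree
  \<open>q + J\<close>, fixes \<open>h\<close> and changes the sign of each factor
  \<open>1 - t\<close>.\<close>

lemma hcoeff_palindromic:
  "d \<le> q + J \<Longrightarrow> hcoeff J (of_nat q) d = (-1) ^ q * hcoeff J (of_nat q) (q + J - d)"
proof (induction q arbitrary: d)
  case 0
  then show ?case by (simp add: hcoeff_def one_minus_X_powr_0 h_fps_palindromic)
next
  case (Suc q)
  have step: "hcoeff J (of_nat (Suc q)) (Suc d) = hcoeff J (of_nat q) (Suc d) - hcoeff J (of_nat q) d" for d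
    using hcoeff_add_1[of J "of_nat q" d] by (simp add: add.commute)
  \<comment> \<open>The top coefficient loses one term of the recursion, which lies beyond the
    degree; in the interior both terms need the induction hypothesis.\<close>
  consider "d = 0" | "d = Suc (q + J)" | e where "d = Suc e" "Suc e \<le> q + J"
    using Suc.prems by (cases d) force+
  then show ?case
  proof cases
    case 1
    then show ?thesis
      using Suc.IH[of 0] step[of "q + J"] by (simp add: hcoeff_at_0 hcoeff_of_nat_eq_0 del: of_nat_Suc)
  next
    case 2
    then show ?thesis
      using Suc.IH[of "q + J"] step[of "q + J"]
      by (simp add: hcoeff_at_0 hcoeff_of_nat_eq_0 del: of_nat_Suc)
  next
    case 3
    then obtain c where c: "q + J = Suc e + c" by (auto simp: le_iff_add)
    show ?thesis
      using Suc.IH[of "Suc e"] Suc.IH[of e] 3 c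
      by (simp add: Suc_diff_le step right_diff_distrib del: of_nat_Suc)
  qed
qed

text \<open>Pfaff in degree \<open>J\<close> takes the exponent \<open>J + l\<close> to
  \<open>J - l\<close>, palindromy lowers the degree to \<open>J - l\<close>, and Pfaff in that
  degree takes the exponent to \<open>J\<close>.\<close>

lemma hcoeff_reflection:
  assumes "l \<le> J"
  shows "(-1) ^ J * hcoeff J (of_nat J + of_nat l) J = hcoeff J (of_nat J) (J - l)"
proof -
  have "(-1) ^ J * hcoeff J (of_nat J + of_nat l) J = hcoeff J (of_nat (J - l)) J"
    using hcoeff_Pfaff[of J J "of_nat J + of_nat l"] assms by (simp add: of_nat_diff minus_one_power_cancel)
  also have "\<dots> = (-1) ^ (J - l) * hcoeff J (of_nat (J - l)) (J - l)"
    using hcoeff_palindromic[of J "J - l" J] by simp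
  also have "\<dots> = hcoeff J (of_nat J) (J - l)"
    using hcoeff_Pfaff[of "J - l" J "of_nat (J - l)"] by (simp add: minus_one_power_cancel)
  finally show ?thesis .
qed

text \<open>The case \<open>l = J + 1\<close>, out of reach of \<open>hcoeff_reflection\<close>.
  Pfaff turns it into the normalisation \<open>h(1) = 1\<close>, a Vandermonde sum.\<close>

lemma hcoeff_top: "(-1) ^ J * hcoeff J (2 * of_nat J + 1) J = 1"
proof -
  let ?B = "fps_nth (one_minus_X_powr (- of_nat J - 1))"
  let ?N = "of_nat ((3 * J + 1) choose J) :: rat"
  \<comment> \<open>The exponent -1 is written in the form of
    \<open>one_minus_X_powr_neg_nth\<close>; all coefficients of that series are 1.\<close>
  have "(-1) ^ J * hcoeff J (2 * of_nat J + 1) J = hcoeff J (- of_nat 0 - 1) J"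
    using hcoeff_Pfaff[of J J "2 * of_nat J + 1"]
    by (simp add: minus_one_power_cancel)
  also have "\<dots> = (\<Sum>a=0..J. fps_nth (h_fps J) a)"
    unfolding hcoeff_def fps_mult_nth one_minus_X_powr_neg_nth by simp
  also have "\<dots> = (\<Sum>a=0..J. ?B a * ?B (J - a) / ?N)"
  proof (rule sum.cong[OF refl])
    fix a assume "a \<in> {0..J}"
    then show "fps_nth (h_fps J) a = ?B a * ?B (J - a) / ?N"
      using binomial_symmetric[of J "J + a"] binomial_symmetric[of J "2 * J - a"]
      by (simp add: h_fps_def one_minus_X_powr_neg_nth mult_2 add.commute)
  qed
  also have "\<dots> = fps_nth (one_minus_X_powr (- of_nat (2 * J + 1) - 1)) J / ?N"
    using one_minus_X_powr_add[of "- of_nat J - 1" "- of_nat J - 1"]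
    by (simp add: sum_divide_distrib[symmetric] fps_mult_nth[symmetric] minus_diff_commute)
  also have "\<dots> = 1"
    unfolding one_minus_X_powr_neg_nth by (simp add: numeral_3_eq_3)
  finally show ?thesis .
qed

section \<open>Rows dual to the matrix \<open>K\<close>\<close>

text \<open>The sign \<open>e = 1\<close> gives the entries of \<open>K_n\<close>, and
  \<open>e = -1\<close> those of its transpose.\<close>

definition K_entry :: "rat \<Rightarrow> nat \<Rightarrow> nat \<Rightarrow> rat" where
  "K_entry e i j = of_nat ((i + j) choose i) + e * ((-1) ^ i * of_nat (j choose i) - (-1) ^ j * of_nat (i choose j))"

definition dual_row :: "rat \<Rightarrow> nat \<Rightarrow> nat \<Rightarrow> rat" where
  "dual_row e J k = (if k \<le> J
     then (1 + e * (-1) ^ J) * hcoeff J (of_nat J + 1) (J - k) - e * (-1) ^ J * hcoeff J (of_nat J) (J - k)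
     else 0)"

lemma K_entry_transpose: "K_entry (- e) i j = K_entry e j i"
  using binomial_symmetric[of i "i + j"] by (simp add: K_entry_def add.commute algebra_simps)

lemma sum_hcoeff_pascal_matrix:
  "(\<Sum>k\<le>J. hcoeff J p (J - k) * of_nat ((k + l) choose k)) = hcoeff J (p - of_nat l - 1) J"
  using hcoeff_add[of J p "- of_nat l - 1" J]
  by (simp add: one_minus_X_powr_neg_nth add_diff_eq)

lemma sum_hcoeff_choose_lower:
  "(\<Sum>k\<le>J. hcoeff J p (J - k) * ((-1) ^ k * of_nat (l choose k))) = hcoeff J (p + of_nat l) J"
  using hcoeff_add[of J p "of_nat l" J] by (simp add: one_minus_X_powr_of_nat_nth)

text \<open>Here \<open>k choose l\<close> is the coefficient of \<open>t^(k - l)\<close> in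
  \<open>(1 - t)^(- l - 1)\<close>, so the degree drops by \<open>l\<close>. The degree
  \<open>j\<close> is separate from \<open>J\<close> for later use in the residues.\<close>

lemma sum_hcoeff_choose_upper:
  assumes "l \<le> j"
  shows "(\<Sum>k\<le>j. hcoeff J p (j - k) * of_nat (k choose l)) = hcoeff J (p - of_nat l - 1) (j - l)"
proof -
  have "(\<Sum>k\<le>j. hcoeff J p (j - k) * of_nat (k choose l))
      = (\<Sum>k\<in>{l..j}. hcoeff J p (j - k) * of_nat (k choose l))"
    by (rule sum.mono_neutral_right) (auto simp: not_le binomial_eq_0)
  also have "\<dots> = (\<Sum>k\<le>j - l. hcoeff J p (j - l - k) * of_nat ((k + l) choose k))"
  proof (rule sum.reindex_bij_witness[of _ "\<lambda>k. k + l" "\<lambda>k. k - l"])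
    fix k assume "k \<in> {l..j}"
    then show "hcoeff J p (j - l - (k - l)) * of_nat ((k - l + l) choose (k - l))
        = hcoeff J p (j - k) * of_nat (k choose l)"
      using binomial_symmetric[of l k] by simp
  qed (use assms in auto)
  also have "\<dots> = hcoeff J (p - of_nat l - 1) (j - l)"
    using hcoeff_add[of J p "- of_nat l - 1" "j - l"]
    by (simp add: one_minus_X_powr_neg_nth add_diff_eq)
  finally show ?thesis .
qed

text \<open>For \<open>e * e = 1\<close> this makes \<open>dual_row e J\<close> the last row of the
  inverse of the leading block of size \<open>J + 1\<close>. The three terms of
  \<open>K_entry\<close> give coefficients of \<open>h\<close> times powers of \<open>1 - t\<close>;
  the symmetries reduce them to \<open>c\<close>, \<open>c'\<close> and \<open>\<delta>\<close>,
  leaving an identity in the signs \<open>e\<close>, \<open>s\<close>, \<open>t\<close>.\<close>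

lemma dual_row_mult_K:
  assumes e: "e * e = 1" and l: "l \<le> J"
  shows "(\<Sum>k\<le>J. dual_row e J k * K_entry e k l) = (if l = J then 1 else 0)"
proof -
  define s t :: rat where "s = (-1) ^ J" and "t = (-1) ^ l"
  define c where "c = hcoeff J (of_nat J) (J - l)"
  \<comment> \<open>At \<open>l = J\<close> the intended index is -1, hence the value 0; natural
    subtraction would give the index 0.\<close>
  define c' where "c' = (if l = J then 0 else hcoeff J (of_nat J) (J - Suc l))"
  define \<delta> :: rat where "\<delta> = (if l = J then 1 else 0)"
  have row: "(\<Sum>k\<le>J. hcoeff J p (J - k) * K_entry e k l)
      = hcoeff J (p - of_nat l - 1) J
        + e * (hcoeff J (p + of_nat l) J - t * hcoeff J (p - of_nat l - 1) (J - l))" for p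
    unfolding sum_hcoeff_pascal_matrix[symmetric] sum_hcoeff_choose_lower[symmetric]
      sum_hcoeff_choose_upper[OF l, symmetric]
    by (simp add: K_entry_def t_def sum_distrib_left sum.distrib sum_subtractf algebra_simps)
  have "(\<Sum>k\<le>J. dual_row e J k * K_entry e k l)
      = (\<Sum>k\<le>J. (1 + e * s) * (hcoeff J (of_nat J + 1) (J - k) * K_entry e k l)
               - e * s * (hcoeff J (of_nat J) (J - k) * K_entry e k l))"
    by (intro sum.cong refl) (simp add: dual_row_def s_def algebra_simps)
  also have "\<dots> = (1 + e * s) * (hcoeff J (of_nat J - of_nat l) J
        + e * (hcoeff J (of_nat J + 1 + of_nat l) J - t * hcoeff J (of_nat J - of_nat l) (J - l)))
      - e * s * (hcoeff J (of_nat J - of_nat l - 1) J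
        + e * (hcoeff J (of_nat J + of_nat l) J - t * hcoeff J (of_nat J - of_nat l - 1) (J - l)))"
    by (simp add: sum_subtractf sum_distrib_left[symmetric] row)
  finally have expand: "(\<Sum>k\<le>J. dual_row e J k * K_entry e k l) = \<dots>" .
  have ss: "s * s = 1" and tt: "t * t = 1"
    by (simp_all add: s_def t_def power_add[symmetric])
  have sl: "(-1) ^ (J - l) = s * t"
    using l by (auto simp: s_def t_def le_iff_add power_add mult_ac minus_one_power_cancel)
  have b0: "hcoeff J (of_nat J + of_nat l) J = s * c"
    unfolding c_def hcoeff_reflection[OF l, symmetric] s_def minus_one_power_cancel ..
  have b1: "hcoeff J (of_nat J + 1 + of_nat l) J = s * (c' + \<delta>)"
  proof (cases "l = J")
    case True
    then have "of_nat J + 1 + of_nat l = 2 * of_nat J + (1 :: rat)" by simp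
    moreover have "hcoeff J (2 * of_nat J + 1) J = s"
      using hcoeff_top[of J] ss unfolding s_def[symmetric] by (metis mult.assoc mult.left_neutral mult.right_neutral)
    ultimately show ?thesis using True by (simp only: c'_def \<delta>_def if_True) simp
  next
    case False
    then have "s * hcoeff J (of_nat J + of_nat (Suc l)) J = c'"
      using hcoeff_reflection[of "Suc l" J] l by (simp add: c'_def s_def)
    then have "hcoeff J (of_nat J + of_nat (Suc l)) J = s * c'"
      using ss by (metis mult.assoc mult.left_neutral)
    then show ?thesis using False by (simp add: \<delta>_def add_ac)
  qed
  have a0: "hcoeff J (of_nat J - of_nat l) J = c"
    using hcoeff_Pfaff[of J J "of_nat J - of_nat l"] b0 ss by (simp add: s_def mult.assoc[symmetric])
  have a1: "hcoeff J (of_nat J - of_nat l - 1) J = c' + \<delta>"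
    using hcoeff_Pfaff[of J J "of_nat J - of_nat l - 1"] b1 ss
    by (simp add: s_def mult.assoc[symmetric] add_ac)
  have g0: "hcoeff J (of_nat J - of_nat l) (J - l) = s * t * c"
    using hcoeff_Pfaff[of "J - l" J "of_nat J - of_nat l"] l by (simp add: sl c_def of_nat_diff)
  have g1: "hcoeff J (of_nat J - of_nat l - 1) (J - l) = s * t * (c - c')"
  proof -
    have "hcoeff J (of_nat J + 1) (J - l) = c - c'"
    proof (cases "l = J")
      case True
      then show ?thesis by (simp add: c_def c'_def hcoeff_at_0)
    next
      case False
      then have "J - l = Suc (J - Suc l)" using l by simp
      then show ?thesis using False by (simp add: c_def c'_def hcoeff_add_1)
    qed
    then show ?thesis
      using hcoeff_Pfaff[of "J - l" J "of_nat J - of_nat l - 1"] l by (simp add: sl of_nat_diff add_ac)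
  qed
  have cases: "e = 1 \<or> e = -1" "s = 1 \<or> s = -1" "t = 1 \<or> t = -1"
    using e ss tt by (simp_all add: square_eq_1_iff)
  show ?thesis
    unfolding expand a0 a1 b0 b1 g0 g1 \<delta>_def[symmetric] using cases by auto
qed

lemma dual_row_diag: "dual_row e J J = fps_nth (h_fps J) 0"
  by (simp add: dual_row_def hcoeff_at_0 algebra_simps)

lemma dual_row_eq_0: "J < k \<Longrightarrow> dual_row e J k = 0"
  by (simp add: dual_row_def)

text \<open>Triangularity cuts off the sums. If \<open>j <= i\<close>, row \<open>i\<close>
  annihilates every column before \<open>i\<close>, so only a diagonal entry can survive; otherwise
  transposition lets row \<open>j\<close> for \<open>- e\<close> act first and annihilate all
  columns up to \<open>i\<close>.\<close>

lemma dual_rows_biorthogonal: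
  assumes e: "e * e = 1" and "i < n" "j < n"
  shows "(\<Sum>k<n. \<Sum>l<n. dual_row e i k * K_entry e k l * dual_row (- e) j l)
       = (if i = j then fps_nth (h_fps i) 0 else 0)"
proof -
  have restrict: "(\<Sum>k<n. dual_row e' i k * f k) = (\<Sum>k\<le>i. dual_row e' i k * f k)" if "i < n" for e' i f
    using that by (intro sum.mono_neutral_right) (auto simp: dual_row_eq_0)
  show ?thesis
  proof (cases "j \<le> i")
    case True
    have "(\<Sum>k<n. \<Sum>l<n. dual_row e i k * K_entry e k l * dual_row (- e) j l)
        = (\<Sum>l<n. dual_row (- e) j l * (\<Sum>k<n. dual_row e i k * K_entry e k l))"
      by (subst sum.swap) (simp add: sum_distrib_left mult_ac)
    also have "\<dots> = (\<Sum>l\<le>j. dual_row (- e) j l * (\<Sum>k\<le>i. dual_row e i k * K_entry e k l))"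
      using assms by (simp add: restrict)
    also have "\<dots> = (\<Sum>l\<le>j. dual_row (- e) j l * (if l = i then 1 else 0))"
      using True e by (intro sum.cong refl) (simp add: dual_row_mult_K)
    also have "\<dots> = (if i = j then fps_nth (h_fps i) 0 else 0)"
      using True by (auto simp: dual_row_diag if_distrib sum.delta cong: if_cong)
    finally show ?thesis .
  next
    case False
    have "(\<Sum>k<n. \<Sum>l<n. dual_row e i k * K_entry e k l * dual_row (- e) j l)
        = (\<Sum>k<n. dual_row e i k * (\<Sum>l<n. dual_row (- e) j l * K_entry (- e) l k))"
      by (simp add: sum_distrib_left mult_ac K_entry_transpose)
    also have "\<dots> = (\<Sum>k\<le>i. dual_row e i k * (\<Sum>l\<le>j. dual_row (- e) j l * K_entry (- e) l k))"
      using assms by (simp add: restrict)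
    also have "\<dots> = 0"
      using False e by (intro sum.neutral) (simp add: dual_row_mult_K)
    finally show ?thesis using False by simp
  qed
qed

section \<open>The constants \<open>b_m\<close> and \<open>A_n\<close>\<close>

lemma h_fps_at_0: "fps_nth (h_fps J) 0 = b_const (Suc J)"
  by (simp add: h_fps_def b_const_def h_poly_def sum.remove[of _ 0] power_0_left)

lemma b_const_Suc_pos: "b_const (Suc J) > 0"
  unfolding h_fps_at_0[symmetric] by (simp add: h_fps_def)

lemma A_const_Suc: "A_const (Suc n) * b_const (Suc n) = A_const n"
proof -
  have shift: "(\<Prod>j<n. fact (n + j)) * fact (2 * n) * fact (2 * n + 1)
      = fact n * (\<Prod>j<Suc n. fact (Suc n + j) :: rat)"
  proof -
    \<comment> \<open>Both sides of \<open>shift\<close> are the product of all factorials from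
      \<open>n!\<close> to \<open>(2 n + 1)!\<close>.\<close>
    have "(\<Prod>j<n. fact (n + j)) * fact (2 * n) * fact (2 * n + 1) = (\<Prod>j<Suc (Suc n). fact (n + j) :: rat)"
      by (simp add: mult_2[symmetric])
    also have "\<dots> = fact n * (\<Prod>j<Suc n. fact (Suc n + j))"
      by (subst prod.lessThan_Suc_shift) simp
    finally show ?thesis .
  qed
  have b: "b_const (Suc n) = fact (2 * n) * fact (2 * n + 1) / (fact n * fact (3 * n + 1))"
  proof -
    have "b_const (Suc n) = of_nat ((2 * n) choose n) / of_nat ((3 * n + 1) choose n)"
      unfolding h_fps_at_0[symmetric] by (simp add: h_fps_def)
    moreover have "of_nat ((2 * n) choose n) = (fact (2 * n) / (fact n * fact n) :: rat)"
      using binomial_fact[of n "2 * n", where 'a = rat] by (simp add: mult_2)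
    moreover have "3 * n + 1 - n = 2 * n + 1" by simp
    then have "of_nat ((3 * n + 1) choose n) = (fact (3 * n + 1) / (fact n * fact (2 * n + 1)) :: rat)"
      using binomial_fact[of n "3 * n + 1", where 'a = rat] by (simp del: fact_Suc)
    ultimately show ?thesis by (simp del: fact_Suc)
  qed
  have nz: "(\<Prod>j<n. fact (n + j)) \<noteq> (0 :: rat)" "(\<Prod>j<Suc n. fact (Suc n + j)) \<noteq> (0 :: rat)"
    by (simp_all del: prod.lessThan_Suc)
  have A: "A_const (Suc n) = (\<Prod>j<n. fact (3 * j + 1)) * fact (3 * n + 1) / (\<Prod>j<Suc n. fact (Suc n + j))"
    by (simp add: A_const_def prod_dividef del: prod.lessThan_Suc) simp
  have A': "A_const n = (\<Prod>j<n. fact (3 * j + 1)) / (\<Prod>j<n. fact (n + j))"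
    by (simp add: A_const_def prod_dividef)
  have f: "fact n * fact (3 * n + 1) \<noteq> (0::rat)" "fact n \<noteq> (0::rat)" "fact (3 * n + 1) \<noteq> (0::rat)"
    by simp_all
  show ?thesis
    unfolding A A' b using nz shift f
    by (simp add: divide_simps del: prod.lessThan_Suc fact_Suc) (simp add: mult_ac)
qed

lemma A_const_mult_prod: "A_const n * (\<Prod>i<n. b_const (Suc i)) = 1"
proof (induction n)
  case 0
  show ?case by (simp add: A_const_def)
next
  case (Suc n)
  have "A_const (Suc n) * (\<Prod>i<Suc n. b_const (Suc i))
      = (A_const (Suc n) * b_const (Suc n)) * (\<Prod>i<n. b_const (Suc i))"
    by (simp add: mult_ac)
  then show ?case unfolding A_const_Suc Suc.IH .
qed

section \<open>The residues defining \<open>M\<close>\<close>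

definition f_gen :: "'a \<Rightarrow> nat \<Rightarrow> nat \<Rightarrow> 'a::field_char_0 \<Rightarrow> 'a" where
  "f_gen \<sigma> i m z = (1 + \<sigma> * z) * (1 - z) ^ i * z powi (- int i - 1) * h_poly m z"

lemma f_plus_eq_f_gen: "f_plus n s i = f_gen ((-1) ^ (i + 1)) i (m_idx n s i)"
  by (intro ext) (simp add: f_plus_def f_gen_def)

lemma f_minus_eq_f_gen: "f_minus n s i = f_gen (- ((-1) ^ (i + 1))) i (m_idx n s i)"
  by (intro ext) (simp add: f_minus_def f_gen_def)

definition f_numer :: "rat \<Rightarrow> nat \<Rightarrow> nat \<Rightarrow> rat fps" where
  "f_numer \<sigma> i J = (1 + fps_const \<sigma> * fps_X) * (1 - fps_X) ^ i * h_fps J"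

text \<open>Writing \<open>1 + \<sigma> X = (1 + \<sigma>) - \<sigma> (1 - X)\<close> gives two
  consecutive exponents, as in \<open>dual_row\<close>.\<close>

lemma f_numer_nth:
  "fps_nth (f_numer \<sigma> i J) k = (1 + \<sigma>) * hcoeff J (of_nat i) k - \<sigma> * hcoeff J (of_nat i + 1) k"
proof -
  have "f_numer \<sigma> i J = fps_const (1 + \<sigma>) * (h_fps J * one_minus_X_powr (of_nat i))
      - fps_const \<sigma> * (h_fps J * one_minus_X_powr (of_nat i + 1))"
    by (simp add: f_numer_def one_minus_X_powr_of_nat one_minus_X_powr_add[symmetric] one_minus_X_powr_1
        fps_const_add[symmetric] algebra_simps del: fps_const_add)
  then show ?thesis by (simp add: hcoeff_def)
qed

section \<open>Evaluation at the formal variables\<close>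

lemma h_poly_fls_const: "h_poly m (fls_const x) = fls_const (h_poly m x)"
proof -
  have sum: "fls_const (sum f A) = (\<Sum>a\<in>A. fls_const (f a))" if "finite A" for f :: "nat \<Rightarrow> 'a" and A
    using that by (induction A rule: finite_induct) (simp_all add: fls_plus_const[symmetric])
  show ?thesis
    by (simp add: h_poly_def sum fls_of_nat fls_const_power[symmetric] fls_const_divide_const[symmetric])
qed

lemma f_gen_fls_const: "f_gen (fls_const \<sigma>) i m (fls_const x) = fls_const (f_gen \<sigma> i m x)"
  by (simp add: f_gen_def h_poly_fls_const fls_const_power fls_const_power_int
      fls_plus_const[symmetric] fls_minus_const[symmetric] fls_const_mult_const[symmetric] del: fls_const_mult_const)

lemma of_rat_fls: "(of_rat r :: rat fls) = fls_const r"
proof (cases r)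
  case (Fract a b)
  then show ?thesis
    by (simp add: Fract_of_int_quotient of_rat_divide fls_of_int fls_const_divide_const)
qed

text \<open>The same rational series is expanded over \<open>rat\<close> for \<open>z\<close> and
  over \<open>rat fls\<close> for \<open>w\<close>.\<close>

definition fps_of_rat :: "rat fps \<Rightarrow> 'a::field_char_0 fps" where
  "fps_of_rat F = Abs_fps (\<lambda>k. of_rat (fps_nth F k))"

lemma fps_of_rat_nth [simp]: "fps_nth (fps_of_rat F) k = of_rat (fps_nth F k)"
  by (simp add: fps_of_rat_def)

lemma fps_of_rat_mult: "fps_of_rat (F * G) = fps_of_rat F * fps_of_rat G"
  by (rule fps_ext) (simp add: fps_mult_nth of_rat_sum of_rat_mult)

lemma fps_of_rat_1: "fps_of_rat 1 = 1"
  by (rule fps_ext) simp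

lemma fps_of_rat_power: "fps_of_rat (F ^ k) = fps_of_rat F ^ k"
  by (induction k) (simp_all add: fps_of_rat_1 fps_of_rat_mult)

lemma fps_of_rat_linear: "fps_of_rat (1 + fps_const c * fps_X) = 1 + fps_const (of_rat c) * fps_X"
  by (rule fps_ext) (simp add: fps_X_def of_rat_add)

lemma h_poly_fls_X: "h_poly (Suc J) (fls_X :: 'a::field_char_0 fls) = fps_to_fls (fps_of_rat (h_fps J))"
proof (rule fls_eqI)
  fix k :: int
  have "fls_nth (h_poly (Suc J) (fls_X :: 'a fls)) k
      = (\<Sum>a<Suc J. if int a = k then of_rat (fps_nth (h_fps J) a) else 0)"
    unfolding h_poly_def fls_nth_sum
  proof (intro sum.cong refl)
    fix a assume "a \<in> {..<Suc J}"
    then show "fls_nth (of_nat ((Suc J + a - 1) choose (Suc J - 1)) * of_nat ((2 * Suc J - a - 2) choose (Suc J - 1))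
          / of_nat ((3 * Suc J - 2) choose (Suc J - 1)) * fls_X ^ a) k
        = (if int a = k then of_rat (fps_nth (h_fps J) a) else (0 :: 'a))"
      unfolding fls_of_nat fls_const_mult_const fls_const_divide_const
        fls_X_power_times_conv_shift
      by (auto simp: h_fps_def of_rat_mult of_rat_divide)
  qed
  also have "\<dots> = fls_nth (fps_to_fls (fps_of_rat (h_fps J))) k"
  proof (cases "k \<ge> 0")
    case True
    then have "int a = k \<longleftrightarrow> a = nat k" for a by auto
    then show ?thesis using True by (simp add: h_fps_def del: sum.lessThan_Suc)
  next
    case False
    then show ?thesis by (auto intro!: sum.neutral)
  qed
  finally show "fls_nth (h_poly (Suc J) (fls_X :: 'a fls)) k = fls_nth (fps_to_fls (fps_of_rat (h_fps J))) k" .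
qed

lemma f_gen_fls_X:
  "f_gen (fls_const (of_rat \<sigma>)) i (Suc J) (fls_X :: 'a::field_char_0 fls)
     = fls_shift (int i + 1) (fps_to_fls (fps_of_rat (f_numer \<sigma> i J)))"
proof -
  have minus: "(1 - fps_X :: 'b::field_char_0 fps) = 1 + fps_const (-1) * fps_X"
    by (rule fps_ext) (simp add: fps_X_def)
  have "f_gen (fls_const (of_rat \<sigma>)) i (Suc J) (fls_X :: 'a fls)
      = fls_X_intpow (- int i - 1) * fps_to_fls (fps_of_rat (f_numer \<sigma> i J))"
    unfolding f_numer_def minus fps_of_rat_mult fps_of_rat_power fps_of_rat_linear
    by (simp add: f_gen_def h_poly_fls_X fls_times_fps_to_fls fps_to_fls_power mult_ac)
  then show ?thesis by (simp only: fls_X_intpow_times_conv_shift) (simp add: add.commute)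
qed

text \<open>The geometric series in \<open>w / (1 - z)\<close>, stated for the whole series so that
  it can be multiplied.\<close>

lemma inverse_kernel:
  "inverse (1 - var_z - var_w)
     = fps_to_fls (Abs_fps (\<lambda>l. fps_to_fls (one_minus_X_powr (- of_nat l - 1))))" (is "_ = fps_to_fls ?G")
proof (rule inverse_unique)
  have step: "(1 - fls_X) * fps_to_fls (one_minus_X_powr q) = fps_to_fls (one_minus_X_powr (q + 1))" for q
    using one_minus_X_powr_add[of 1 q]
    by (simp add: one_minus_X_powr_1 fls_times_fps_to_fls[symmetric] add.commute flip: fps_to_fls_minus fps_one_to_fls fps_X_to_fls)
  have "(fps_const (1 - fls_X) - fps_X) * ?G = 1"
  proof (rule fps_ext)
    fix l show "fps_nth ((fps_const (1 - fls_X) - fps_X) * ?G) l = fps_nth 1 l"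
      by (cases l)
        (simp_all add: left_diff_distrib[of "fps_const (1 - fls_X)"] step one_minus_X_powr_0 minus_diff_commute)
  qed
  from arg_cong[OF this, of fps_to_fls]
  show "(1 - var_z - var_w) * fps_to_fls ?G = 1"
    by (simp add: fls_times_fps_to_fls var_z_def var_w_def fls_minus_const[symmetric])
qed

text \<open>After the factors \<open>z^(- i - 1)\<close> and \<open>w^(- j - 1)\<close> are split
  off, the numerator terms \<open>k\<close> and \<open>l\<close> meet the kernel coefficient at
  \<open>z^(i - k) w^(j - l)\<close>.\<close>

lemma res_f_gen:
  "res_z_res_w (f_gen (fls_const (fls_const \<sigma>)) i (Suc J) var_z
       * f_gen (fls_const (fls_const \<tau>)) j (Suc J') var_w / (1 - var_z - var_w))
   = (\<Sum>k\<le>i. \<Sum>l\<le>j. fps_nth (f_numer \<sigma> i J) k * fps_nth (f_numer \<tau> j J') l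
        * of_nat ((i - k + (j - l)) choose (i - k)))"
proof -
  let ?G = "Abs_fps (\<lambda>l. fps_to_fls (one_minus_X_powr (- of_nat l - 1)))"
  define A :: "rat fls" where "A = fls_shift (int i + 1) (fps_to_fls (f_numer \<sigma> i J))"
  have id: "fps_of_rat F = F" for F :: "rat fps"
    by (rule fps_ext) (simp add: of_rat_eq_id)
  have z: "f_gen (fls_const (fls_const \<sigma>)) i (Suc J) var_z = fls_const A"
    using f_gen_fls_X[of \<sigma> i J, where 'a = rat] unfolding id
    by (simp add: var_z_def f_gen_fls_const A_def of_rat_eq_id)
  have w: "f_gen (fls_const (fls_const \<tau>)) j (Suc J') var_w
      = fls_shift (int j + 1) (fps_to_fls (fps_of_rat (f_numer \<tau> j J')))"
    using f_gen_fls_X[of \<tau> j J', where 'a = "rat fls"] by (simp add: var_w_def of_rat_fls)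
  have "f_gen (fls_const (fls_const \<sigma>)) i (Suc J) var_z
       * f_gen (fls_const (fls_const \<tau>)) j (Suc J') var_w / (1 - var_z - var_w)
     = fls_const A * fls_shift (int j + 1) (fps_to_fls (fps_of_rat (f_numer \<tau> j J') * ?G))"
    unfolding divide_inverse inverse_kernel z w
    by (simp add: fls_times_fps_to_fls fls_shifted_times_simps mult.assoc)
  \<comment> \<open>The z-factor is constant in \<open>w\<close>, and the shift by
    \<open>j + 1\<close> makes the w-residue a coefficient of degree \<open>j\<close>.\<close>
  then have "fls_residue (f_gen (fls_const (fls_const \<sigma>)) i (Suc J) var_z
       * f_gen (fls_const (fls_const \<tau>)) j (Suc J') var_w / (1 - var_z - var_w))
     = A * fps_nth (fps_of_rat (f_numer \<tau> j J') * ?G) j"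
    by simp
  also have "\<dots> = (\<Sum>l\<le>j. fls_const (fps_nth (f_numer \<tau> j J') l)
        * fls_shift (int i + 1) (fps_to_fls (f_numer \<sigma> i J * one_minus_X_powr (- of_nat (j - l) - 1))))"
    by (simp add: A_def fps_mult_nth atMost_atLeast0 sum_distrib_left of_rat_fls fls_times_fps_to_fls
        fls_shifted_times_simps mult_ac)
  finally have res: "fls_residue (f_gen (fls_const (fls_const \<sigma>)) i (Suc J) var_z
       * f_gen (fls_const (fls_const \<tau>)) j (Suc J') var_w / (1 - var_z - var_w)) = \<dots>" .
  have "res_z_res_w (f_gen (fls_const (fls_const \<sigma>)) i (Suc J) var_z
       * f_gen (fls_const (fls_const \<tau>)) j (Suc J') var_w / (1 - var_z - var_w))
     = (\<Sum>l\<le>j. fps_nth (f_numer \<tau> j J') l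
          * fps_nth (f_numer \<sigma> i J * one_minus_X_powr (- of_nat (j - l) - 1)) i)"
    unfolding res_z_res_w_def res by (simp add: fls_nth_sum)
  also have "\<dots> = (\<Sum>l\<le>j. \<Sum>k\<le>i. fps_nth (f_numer \<sigma> i J) k * fps_nth (f_numer \<tau> j J') l
        * of_nat ((i - k + (j - l)) choose (i - k)))"
    unfolding fps_mult_nth one_minus_X_powr_neg_nth atMost_atLeast0 sum_distrib_left
    by (simp add: mult_ac)
  also have "\<dots> = (\<Sum>k\<le>i. \<Sum>l\<le>j. fps_nth (f_numer \<sigma> i J) k * fps_nth (f_numer \<tau> j J') l
        * of_nat ((i - k + (j - l)) choose (i - k)))"
    by (rule sum.swap)
  finally show ?thesis .
qed

text \<open>With \<open>J = r + i\<close>, Pfaff in degree \<open>i - c = J - (r + c)\<close> turns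
  the exponents \<open>i - c - 1\<close> and \<open>i - c\<close> into \<open>J + 1\<close> and
  \<open>J\<close>, the two exponents of \<open>dual_row\<close>.\<close>

lemma sum_f_numer_choose:
  assumes "c \<le> i"
  shows "(\<Sum>k\<le>i. fps_nth (f_numer (e * (-1) ^ (r + i)) i (r + i)) k * of_nat ((i - k) choose c))
       = (-1) ^ (i - c) * dual_row e (r + i) (r + c)"
proof -
  let ?J = "r + i" and ?\<sigma> = "e * (-1) ^ (r + i)"
  have "(\<Sum>k\<le>i. fps_nth (f_numer ?\<sigma> i ?J) k * of_nat ((i - k) choose c))
      = (\<Sum>k\<le>i. fps_nth (f_numer ?\<sigma> i ?J) (i - k) * of_nat (k choose c))"
    by (rule sum.reindex_bij_witness[of _ "\<lambda>k. i - k" "\<lambda>k. i - k"]) auto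
  also have "\<dots> = (1 + ?\<sigma>) * (\<Sum>k\<le>i. hcoeff ?J (of_nat i) (i - k) * of_nat (k choose c))
      - ?\<sigma> * (\<Sum>k\<le>i. hcoeff ?J (of_nat i + 1) (i - k) * of_nat (k choose c))"
    unfolding f_numer_nth sum_distrib_left sum_subtractf[symmetric]
    by (intro sum.cong refl) (simp only: left_diff_distrib mult.assoc)
  also have "\<dots> = (1 + ?\<sigma>) * hcoeff ?J (of_nat i - of_nat c - 1) (i - c)
      - ?\<sigma> * hcoeff ?J (of_nat i - of_nat c) (i - c)"
    unfolding sum_hcoeff_choose_upper[OF assms] by simp
  also have "hcoeff ?J (of_nat i - of_nat c - 1) (i - c) = (-1) ^ (i - c) * hcoeff ?J (of_nat ?J + 1) (i - c)"
    using hcoeff_Pfaff[of "i - c" ?J "of_nat i - of_nat c - 1"] assms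
    by (simp add: of_nat_diff add_ac)
  also have "hcoeff ?J (of_nat i - of_nat c) (i - c) = (-1) ^ (i - c) * hcoeff ?J (of_nat ?J) (i - c)"
    using hcoeff_Pfaff[of "i - c" ?J "of_nat i - of_nat c"] assms
    by (simp add: of_nat_diff add_ac)
  finally show ?thesis
    using assms by (simp add: dual_row_def right_diff_distrib mult_ac)
qed

text \<open>Vandermonde, used as the triangular factorisation of the Pascal matrix that decouples
  the two residue indices.\<close>

lemma sum_choose_choose: "a < N \<Longrightarrow> (\<Sum>c<N. (a choose c) * (b choose c)) = (a + b) choose a"
proof -
  assume "a < N"
  then have "(\<Sum>c<N. (a choose c) * (b choose c)) = (\<Sum>c\<le>a. (b choose c) * (a choose (a - c)))"
    by (intro sum.mono_neutral_cong_right) (auto simp: binomial_symmetric[symmetric] mult.commute)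
  then show ?thesis using vandermonde[of b a a] by (simp add: add.commute)
qed

text \<open>The sign \<open>e\<close> is chosen so that \<open>e * (-1)^(r + i)\<close> is the sign
  \<open>(-1)^(i + 1)\<close> in \<open>f_plus\<close>, and \<open>- e\<close> serves
  \<open>f_minus\<close>. Factoring the kernel over \<open>c\<close> then splits the double sum into
  two dual row entries.\<close>

lemma M_mat_entry:
  assumes "s \<le> n" "i < s" "j < s"
  defines "r \<equiv> n - s" and "e \<equiv> - ((-1) ^ (n - s))"
  shows "M_mat n s $$ (i, j) * b_const (Suc (r + j))
       = (\<Sum>c<s. (-1) ^ (i + j) * (dual_row e (r + i) (r + c) * dual_row (- e) (r + j) (r + c)))"
proof -
  let ?p = "fps_nth (f_numer (e * (-1) ^ (r + i)) i (r + i))"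
  let ?q = "fps_nth (f_numer (- e * (-1) ^ (r + j)) j (r + j))"
  have sign: "e * (-1) ^ (r + k) = (-1) ^ (k + 1)" "- e * (-1) ^ (r + k) = - ((-1) ^ (k + 1))" for k
    by (simp_all add: e_def r_def power_add minus_one_power_cancel)
  have const: "fls_const (fls_const ((-1) ^ (k + 1))) = ((-1) ^ (k + 1) :: rat fls fls)"
    "fls_const (fls_const (- ((-1) ^ (k + 1)))) = (- ((-1) ^ (k + 1)) :: rat fls fls)" for k
    by (simp_all add: fls_const_power)
  have b: "b_const (Suc (r + j)) \<noteq> 0"
    using b_const_Suc_pos[of "r + j"] by simp
  \<comment> \<open>The sign \<open>(-1)^(i + c)\<close> replaces \<open>(-1)^(i - c)\<close>, so
    the formula also holds for \<open>c > i\<close>, where both sides vanish.\<close>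
  have p: "(\<Sum>k\<le>i. ?p k * of_nat ((i - k) choose c)) = (-1) ^ (i + c) * dual_row e (r + i) (r + c)" for c
  proof (cases "c \<le> i")
    case True
    then show ?thesis
      using sum_f_numer_choose[OF True, of e r] by (auto simp: le_iff_add power_add minus_one_power_cancel mult_ac)
  qed (simp add: binomial_eq_0 dual_row_eq_0)
  have q: "(\<Sum>l\<le>j. ?q l * of_nat ((j - l) choose c)) = (-1) ^ (j + c) * dual_row (- e) (r + j) (r + c)" for c
  proof (cases "c \<le> j")
    case True
    then show ?thesis
      using sum_f_numer_choose[OF True, of "- e" r] by (auto simp: le_iff_add power_add minus_one_power_cancel mult_ac)
  qed (simp add: binomial_eq_0 dual_row_eq_0)
  have "M_mat n s $$ (i, j) * b_const (Suc (r + j))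
      = (\<Sum>k\<le>i. \<Sum>l\<le>j. ?p k * ?q l * of_nat ((i - k + (j - l)) choose (i - k)))"
    unfolding res_f_gen[symmetric] sign const
    using assms(2,3) b by (simp add: M_mat_def f_plus_eq_f_gen f_minus_eq_f_gen m_idx_def r_def)
  also have "\<dots> = (\<Sum>k\<le>i. \<Sum>l\<le>j. \<Sum>c<s. (?p k * of_nat ((i - k) choose c)) * (?q l * of_nat ((j - l) choose c)))"
  proof (intro sum.cong refl)
    fix k l
    show "?p k * ?q l * of_nat ((i - k + (j - l)) choose (i - k))
        = (\<Sum>c<s. (?p k * of_nat ((i - k) choose c)) * (?q l * of_nat ((j - l) choose c)))"
      using assms(2) by (subst sum_choose_choose[of _ s, symmetric]) (simp_all add: sum_distrib_left mult_ac)
  qed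
  also have "\<dots> = (\<Sum>c<s. (\<Sum>k\<le>i. ?p k * of_nat ((i - k) choose c)) * (\<Sum>l\<le>j. ?q l * of_nat ((j - l) choose c)))"
    unfolding sum_product by (simp only: sum.swap[of _ "{..<s}"])
  also have "\<dots> = (\<Sum>c<s. (-1) ^ (i + j) * (dual_row e (r + i) (r + c) * dual_row (- e) (r + j) (r + c)))"
    unfolding p q by (intro sum.cong refl) (simp add: power_add mult_ac minus_one_power_cancel)
  finally show ?thesis .
qed

section \<open>Determinants\<close>

lemma det_triangular_mat:
  fixes f :: "nat \<Rightarrow> nat \<Rightarrow> 'a::comm_ring_1"
  assumes "\<And>i j. i < j \<Longrightarrow> f i j = 0"
  shows "det (mat n n (\<lambda>(i, j). f i j)) = (\<Prod>i<n. f i i)"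
proof -
  have "det (mat n n (\<lambda>(i, j). f i j)) = prod_list (diag_mat (mat n n (\<lambda>(i, j). f i j)))"
    by (rule det_lower_triangular[of n]) (simp_all add: assms)
  also have "\<dots> = (\<Prod>i<n. f i i)"
    by (simp add: prod_list_diag_prod lessThan_atLeast0)
  finally show ?thesis .
qed

lemma mat_mult_mat:
  "mat n m (\<lambda>(i, j). f i j) * mat m k (\<lambda>(i, j). g i j)
     = mat n k (\<lambda>(i, j). \<Sum>l<m. f i l * (g l j :: 'a::semiring_0))"
  by (rule eq_matI) (simp_all add: scalar_prod_def lessThan_atLeast0)

lemma det_scale_rows_cols:
  fixes A :: "'a::comm_ring_1 mat"
  assumes A: "A \<in> carrier_mat n n"
  shows "det (mat n n (\<lambda>(i, j). u i * A $$ (i, j) * v j)) = (\<Prod>i<n. u i) * det A * (\<Prod>i<n. v i)"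
proof -
  let ?D = "\<lambda>u. mat n n (\<lambda>(i, j). if i = j then u i else (0 :: 'a))"
  have D: "det (?D u) = (\<Prod>i<n. u i)" for u
    by (subst det_triangular_mat) auto
  have "mat n n (\<lambda>(i, j). u i * A $$ (i, j) * v j) = ?D u * mat n n (\<lambda>(i, j). A $$ (i, j)) * ?D v"
    unfolding mat_mult_mat
    by (rule eq_matI) (simp_all add: mult_delta_left mult_delta_right)
  also have "mat n n (\<lambda>(i, j). A $$ (i, j)) = A"
    using A by (intro eq_matI) auto
  finally show ?thesis
    using A det_mult[of "?D u * A" n "?D v"] det_mult[of "?D u" n A] mult_carrier_mat[of "?D u" n n A n]
    by (simp add: D)
qed

lemma sum_shift_restrict:
  fixes f :: "nat \<Rightarrow> 'a::comm_monoid_add"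
  shows "(\<Sum>k<r + s. if r \<le> k then f k else 0) = (\<Sum>c<s. f (r + c))"
proof -
  have "(\<Sum>k<r + s. if r \<le> k then f k else 0) = (\<Sum>k\<in>{r..<r + s}. f k)"
    by (rule sum.mono_neutral_cong_right) auto
  also have "\<dots> = (\<Sum>c<s. f (r + c))"
    by (rule sum.reindex_bij_witness[of _ "\<lambda>c. r + c" "\<lambda>k. k - r"]) auto
  finally show ?thesis .
qed

lemma prod_lessThan_split:
  fixes f :: "nat \<Rightarrow> 'a::comm_monoid_mult" and s :: nat
  shows "(\<Prod>i<r + s. f i) = (\<Prod>i<r. f i) * (\<Prod>i<s. f (r + i))"
  by (induction s) (simp_all add: mult.assoc)

section \<open>Block diagonalisation of the pencil\<close>

definition dual_mat :: "rat \<Rightarrow> nat \<Rightarrow> rat mat" where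
  "dual_mat e n = mat n n (\<lambda>(i, j). dual_row e i j)"

definition K_sign_mat :: "rat \<Rightarrow> nat \<Rightarrow> rat mat" where
  "K_sign_mat e n = mat n n (\<lambda>(i, j). K_entry e i j)"

lemma dual_mat_carrier [simp]: "dual_mat e n \<in> carrier_mat n n"
  by (simp add: dual_mat_def)

lemma dual_mat_dim [simp]: "dim_row (dual_mat e n) = n" "dim_col (dual_mat e n) = n"
  by (simp_all add: dual_mat_def)

lemma K_sign_mat_carrier [simp]: "K_sign_mat e n \<in> carrier_mat n n"
  by (simp add: K_sign_mat_def)

lemma E_mat_carrier [simp]: "E_mat n s \<in> carrier_mat n n"
  by (simp add: E_mat_def)

lemma M_mat_carrier [simp]: "M_mat n s \<in> carrier_mat s s"
  by (simp add: M_mat_def)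

lemma M_mat_dim [simp]: "dim_row (M_mat n s) = s" "dim_col (M_mat n s) = s"
  by (simp_all add: M_mat_def)

lemma const_poly_mat_carrier [simp]: "const_poly_mat A \<in> carrier_mat a b \<longleftrightarrow> A \<in> carrier_mat a b"
  by (simp add: const_poly_mat_def)

lemma comm_ring_hom_const_poly: "comm_ring_hom (\<lambda>x :: rat. [:x:])"
  by unfold_locales (simp_all add: one_pCons)

lemma const_poly_mat_mult:
  assumes "A \<in> carrier_mat n n" "B \<in> carrier_mat n n"
  shows "const_poly_mat (A * B) = const_poly_mat A * const_poly_mat B"
proof -
  interpret comm_ring_hom "\<lambda>x :: rat. [:x:]" by (rule comm_ring_hom_const_poly)
  show ?thesis unfolding const_poly_mat_def by (rule mat_hom_mult[OF assms])
qed

lemma det_const_poly_mat: "det (const_poly_mat A) = [:det A:]"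
  unfolding const_poly_mat_def by (rule comm_ring_hom.hom_det[OF comm_ring_hom_const_poly])

lemma transpose_dual_mat: "transpose_mat (dual_mat e n) = mat n n (\<lambda>(i, j). dual_row e j i)"
  unfolding dual_mat_def by (rule eq_matI) auto

lemma mat_conj_pencil:
  fixes A B P Q :: "'a::comm_ring_1 mat"
  assumes "A \<in> carrier_mat n n" "B \<in> carrier_mat n n" "P \<in> carrier_mat n n" "Q \<in> carrier_mat n n"
  shows "P * (A - k \<cdot>\<^sub>m B) * Q = P * A * Q - k \<cdot>\<^sub>m (P * B * Q)"
proof -
  have "P * (A - k \<cdot>\<^sub>m B) = P * A - k \<cdot>\<^sub>m (P * B)"
    using assms by (simp add: mult_minus_distrib_mat[of P n n] mult_smult_distrib[of P n n])
  moreover have "(P * A - k \<cdot>\<^sub>m (P * B)) * Q = P * A * Q - k \<cdot>\<^sub>m (P * B * Q)"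
    using assms by (simp add: minus_mult_distrib_mat[of _ n n] mult_smult_assoc_mat[of _ n n _ n] mult_carrier_mat[of _ n n])
  ultimately show ?thesis by simp
qed

lemma dual_mult_K:
  assumes "e * e = 1"
  shows "dual_mat e n * K_sign_mat e n * transpose_mat (dual_mat (- e) n) = mat n n (\<lambda>(i, j). if i = j then b_const (Suc i) else 0)"
proof (rule eq_matI, goal_cases)
  case (1 i j)
  then have "(dual_mat e n * K_sign_mat e n * transpose_mat (dual_mat (- e) n)) $$ (i, j)
      = (\<Sum>l<n. \<Sum>k<n. dual_row e i k * K_entry e k l * dual_row (- e) j l)"
    unfolding dual_mat_def[of e] K_sign_mat_def transpose_dual_mat mat_mult_mat
    by (simp add: sum_distrib_right)
  also have "\<dots> = (\<Sum>k<n. \<Sum>l<n. dual_row e i k * K_entry e k l * dual_row (- e) j l)"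
    by (rule sum.swap)
  finally show ?case using 1 assms by (simp add: dual_rows_biorthogonal h_fps_at_0)
qed simp_all

text \<open>\<open>E\<close> keeps the columns from \<open>r\<close> on. Rows before
  \<open>r\<close> vanish there by triangularity; the others pair to the entries of
  \<open>M\<close>.\<close>

lemma dual_mult_E:
  assumes s: "s \<le> n" and r: "r = n - s" and e: "e = - ((-1) ^ r)"
  shows "dual_mat e n * E_mat n s * transpose_mat (dual_mat (- e) n) = mat n n (\<lambda>(i, j). if r \<le> i \<and> r \<le> j
    then (-1) ^ (i + j) * (M_mat n s $$ (i - r, j - r) * b_const (Suc j)) else 0)"
proof (rule eq_matI, goal_cases)
  case (1 i j)
  then have ij: "i < n" "j < n" by auto
  have "(dual_mat e n * E_mat n s * transpose_mat (dual_mat (- e) n)) $$ (i, j)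
      = (\<Sum>k<n. (\<Sum>l<n. dual_row e i l * (if l = k \<and> r \<le> l then 1 else 0)) * dual_row (- e) j k)"
    unfolding dual_mat_def[of e] E_mat_def transpose_dual_mat mat_mult_mat r using ij by simp
  also have "\<dots> = (\<Sum>k<r + s. if r \<le> k then dual_row e i k * dual_row (- e) j k else 0)"
  proof (rule sum.cong)
    fix k assume k: "k \<in> {..<r + s}"
    have "(\<Sum>l<n. dual_row e i l * (if l = k \<and> r \<le> l then 1 else 0))
        = (\<Sum>l<n. if l = k then (if r \<le> k then dual_row e i k else 0) else 0)"
      by (intro sum.cong) auto
    then show "(\<Sum>l<n. dual_row e i l * (if l = k \<and> r \<le> l then 1 else 0)) * dual_row (- e) j k
        = (if r \<le> k then dual_row e i k * dual_row (- e) j k else 0)"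
      using k s by (simp add: r)
  qed (use s in \<open>auto simp: r\<close>)
  also have "\<dots> = (\<Sum>c<s. dual_row e i (r + c) * dual_row (- e) j (r + c))"
    by (rule sum_shift_restrict)
  also have "\<dots> = (if r \<le> i \<and> r \<le> j
      then (-1) ^ (i + j) * (M_mat n s $$ (i - r, j - r) * b_const (Suc j)) else 0)"
  proof (cases "r \<le> i \<and> r \<le> j")
    case True
    then obtain a b where ab: "i = r + a" "j = r + b" by (auto simp: le_iff_add)
    moreover have "a < s" "b < s" using ab ij s by (simp_all add: r)
    ultimately have "M_mat n s $$ (a, b) * b_const (Suc j)
        = (-1) ^ (a + b) * (\<Sum>c<s. dual_row e i (r + c) * dual_row (- e) j (r + c))"
      using M_mat_entry[OF s, of a b] unfolding r[symmetric] e[symmetric] by (simp add: sum_distrib_left)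
    moreover have "(-1) ^ (i + j) = ((-1) ^ (a + b) :: rat)"
      by (simp add: ab power_add minus_one_power_cancel mult_ac)
    ultimately show ?thesis using True ab by (simp add: minus_one_power_cancel)
  next
    case False
    then show ?thesis by (auto intro!: sum.neutral simp: dual_row_eq_0)
  qed
  finally show ?case using ij by simp
qed (simp_all add: E_mat_def)

text \<open>\<open>M_mat_entry\<close> ties \<open>e\<close> to the parity of \<open>n - s\<close>.
  The choice is harmless: \<open>e = -1\<close> transposes the pencil, since \<open>E\<close> is
  diagonal.\<close>

lemma det_K_pencil_sign:
  assumes "e * e = 1"
  shows "det (const_poly_mat (K_sign_mat e n) - lam \<cdot>\<^sub>m const_poly_mat (E_mat n s))
     = det (const_poly_mat (K_mat n) - lam \<cdot>\<^sub>m const_poly_mat (E_mat n s))"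
proof -
  let ?L = "const_poly_mat (K_mat n) - lam \<cdot>\<^sub>m const_poly_mat (E_mat n s)"
  have L: "?L \<in> carrier_mat n n"
    by (auto simp: K_mat_def intro!: minus_carrier_mat)
  have "e = 1 \<or> e = -1" using assms by (simp add: square_eq_1_iff)
  then show ?thesis
  proof
    assume "e = 1"
    then have "K_sign_mat e n = K_mat n"
      by (simp add: K_mat_def K_sign_mat_def K_entry_def algebra_simps)
    then show ?thesis by simp
  next
    assume "e = -1"
    then have "const_poly_mat (K_sign_mat e n) - lam \<cdot>\<^sub>m const_poly_mat (E_mat n s) = transpose_mat ?L"
      by (intro eq_matI)
        (auto simp: const_poly_mat_def E_mat_def K_mat_def K_sign_mat_def K_entry_transpose, simp_all add: K_entry_def)
    then show ?thesis using det_transpose[OF L] by simp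
  qed
qed

lemma det_pencil_eq:
  assumes s: "s \<le> n"
  shows "[:\<Prod>i<n. b_const (Suc i):] * det (const_poly_mat (K_mat n) - lam \<cdot>\<^sub>m const_poly_mat (E_mat n s))
     = det (1\<^sub>m s - lam \<cdot>\<^sub>m const_poly_mat (M_mat n s))"
proof -
  define r where "r = n - s"
  define e :: rat where "e = - ((-1) ^ r)"
  have ee: "e * e = 1" by (simp add: e_def power_add[symmetric])
  let ?c = const_poly_mat
  let ?E = "E_mat n s" and ?b = "\<lambda>i. b_const (Suc i)"
  let ?N = "1\<^sub>m s - lam \<cdot>\<^sub>m ?c (M_mat n s)"
  have det_dual: "det (dual_mat \<epsilon> n) = (\<Prod>i<n. ?b i)" for \<epsilon>
    unfolding dual_mat_def by (subst det_triangular_mat) (simp_all add: dual_row_eq_0 dual_row_diag h_fps_at_0)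
  have detR: "det (?c (dual_mat e n)) = [:\<Prod>i<n. ?b i:]" and detR': "det (?c (transpose_mat (dual_mat (- e) n))) = [:\<Prod>i<n. ?b i:]"
    unfolding det_const_poly_mat by (simp_all add: det_dual det_transpose[of _ n])
  \<comment> \<open>The lower right block is \<open>I - \<lambda> M\<close> conjugated by
    alternating signs, with columns scaled by the \<open>b\<close> values; the offset
    \<open>r\<close> enters the sign twice and cancels.\<close>
  let ?Z = "mat s s (\<lambda>(i, j). [:(-1) ^ i:] * ?N $$ (i, j) * [:(-1) ^ j * ?b (r + j):])"
  have rs: "n = r + s" using s by (simp add: r_def)
  have "?c (dual_mat e n) * (?c (K_sign_mat e n) - lam \<cdot>\<^sub>m ?c ?E) * ?c (transpose_mat (dual_mat (- e) n))
      = ?c (dual_mat e n * K_sign_mat e n * transpose_mat (dual_mat (- e) n)) - lam \<cdot>\<^sub>m ?c (dual_mat e n * ?E * transpose_mat (dual_mat (- e) n))"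
    by (simp add: const_poly_mat_mult[of _ n] mult_carrier_mat[of _ n n] mat_conj_pencil[of _ n])
  also have "\<dots> = four_block_mat (mat r r (\<lambda>(i, j). if i = j then [:?b i:] else 0)) (0\<^sub>m r s) (0\<^sub>m s r) ?Z"
    unfolding dual_mult_K[OF ee] dual_mult_E[OF s r_def e_def]
  proof (rule eq_matI, goal_cases)
    case (1 i j)
    then have ij: "i < n" "j < n" by (auto simp: rs)
    show ?case
    proof (cases "r \<le> i \<and> r \<le> j")
      case True
      then obtain a b where ab: "i = r + a" "j = r + b" by (auto simp: le_iff_add)
      with ij have ab_less: "a < s" "b < s" by (simp_all add: rs)
      have sgn: "(-1) ^ (r + a + (r + b)) = ((-1) ^ a * (-1) ^ b :: rat)"
        by (simp add: power_add minus_one_power_cancel mult_ac)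
      show ?thesis
        using ij ab ab_less sgn
        by (simp add: const_poly_mat_def smult_diff_right minus_one_power_cancel mult_ac)
    next
      case False
      then have "i < r \<or> j < r" by auto
      then show ?thesis using ij by (cases "i < r"; cases "j < r") (simp_all add: const_poly_mat_def less_diff_conv2 rs)
    qed
  qed (simp_all add: rs const_poly_mat_def)
  finally have block: "?c (dual_mat e n) * (?c (K_sign_mat e n) - lam \<cdot>\<^sub>m ?c ?E) * ?c (transpose_mat (dual_mat (- e) n)) = \<dots>" .
  have prod_c: "(\<Prod>i\<in>A. [:f i:]) = [:\<Prod>i\<in>A. f i:]" for f :: "nat \<Rightarrow> rat" and A
    by (induction A rule: infinite_finite_induct) (simp_all add: one_pCons)
  have detZ: "det ?Z = [:\<Prod>i<s. ?b (r + i):] * det ?N"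
  proof -
    have "det ?Z = (\<Prod>i<s. [:(-1) ^ i:]) * det ?N * (\<Prod>i<s. [:(-1) ^ i * ?b (r + i):])"
      by (rule det_scale_rows_cols) (intro minus_carrier_mat, simp)
    also have "\<dots> = [:(\<Prod>i<s. (-1) ^ i) * (\<Prod>i<s. (-1) ^ i * ?b (r + i)):] * det ?N"
      unfolding prod_c by (simp add: mult.commute)
    also have "(\<Prod>i<s. (-1) ^ i) * (\<Prod>i<s. (-1) ^ i * ?b (r + i)) = (\<Prod>i<s. ?b (r + i))"
      unfolding prod.distrib[symmetric] by (simp only: minus_one_power_cancel)
    finally show ?thesis .
  qed
  have "[:\<Prod>i<n. ?b i:] * det (?c (K_sign_mat e n) - lam \<cdot>\<^sub>m ?c ?E) * [:\<Prod>i<n. ?b i:]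
      = det (?c (dual_mat e n) * (?c (K_sign_mat e n) - lam \<cdot>\<^sub>m ?c ?E) * ?c (transpose_mat (dual_mat (- e) n)))"
  proof -
    have L: "?c (K_sign_mat e n) - lam \<cdot>\<^sub>m ?c ?E \<in> carrier_mat n n"
      by (intro minus_carrier_mat) simp
    have "?c (dual_mat e n) * (?c (K_sign_mat e n) - lam \<cdot>\<^sub>m ?c ?E) \<in> carrier_mat n n"
      by (intro mult_carrier_mat[OF _ L]) simp
    then show ?thesis
      using det_mult[of "?c (dual_mat e n)" n, OF _ L] by (simp add: det_mult[of _ n] detR detR')
  qed
  also have "\<dots> = det (mat r r (\<lambda>(i, j). if i = j then [:?b i:] else 0)) * det ?Z"
    unfolding block by (rule det_four_block_mat_upper_right_zero[of _ r _ s]) auto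
  also have "\<dots> = [:\<Prod>i<n. ?b i:] * det ?N"
  proof -
    have "det (mat r r (\<lambda>(i, j). if i = j then [:?b i:] else 0)) = [:\<Prod>i<r. ?b i:]"
      by (subst det_triangular_mat) (simp_all add: prod_c)
    moreover have "(\<Prod>i<n. ?b i) = (\<Prod>i<r. ?b i) * (\<Prod>i<s. ?b (r + i))"
      unfolding rs by (rule prod_lessThan_split)
    ultimately show ?thesis unfolding detZ by (simp add: mult.commute)
  qed
  \<comment> \<open>The two outer matrices contribute the product of the \<open>b\<close> values
    twice, the block form only once; one nonzero factor cancels.\<close>
  finally have "[:\<Prod>i<n. ?b i:] * ([:\<Prod>i<n. ?b i:] * det (?c (K_sign_mat e n) - lam \<cdot>\<^sub>m ?c ?E)) = [:\<Prod>i<n. ?b i:] * det ?N"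
    by (simp add: mult_ac)
  moreover have "?b i \<noteq> 0" for i
    using b_const_Suc_pos[of i] by simp
  then have "[:\<Prod>i<n. ?b i:] \<noteq> 0" by simp
  ultimately show ?thesis
    unfolding det_K_pencil_sign[OF ee] by (metis mult_left_cancel)
qed

theorem proposition4p1:
  fixes n s :: nat
  assumes "n \<ge> 1" and "s \<le> n"
  shows "[:A_const n:] * det (1\<^sub>m s - lam \<cdot>\<^sub>m const_poly_mat (M_mat n s))
       = det (const_poly_mat (K_mat n) - lam \<cdot>\<^sub>m const_poly_mat (E_mat n s))"
proof -
  let ?D = "det (const_poly_mat (K_mat n) - lam \<cdot>\<^sub>m const_poly_mat (E_mat n s))"
  have "[:A_const n:] * ([:\<Prod>i<n. b_const (Suc i):] * ?D) = [:A_const n * (\<Prod>i<n. b_const (Suc i)):] * ?D"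
    by (simp add: mult.commute)
  also have "\<dots> = ?D"
    unfolding A_const_mult_prod by simp
  finally show ?thesis
    unfolding det_pencil_eq[OF assms(2)] .
qed

end
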